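(* Let $\mathcal{C}=\{C_\theta:\theta\in\mathcal{O}\}$, with $\mathcal{O}\subset\mathbb{R}^p$, be a parametric family of copulas that are left-tail decreasing (LTD) in both arguments, and let $(X_1,Y_1),\ldots,(X_n,Y_n)$ be a random sample from a bivariate distribution with continuous margins whose copula $C$ is LTD in both arguments and $C\notin\mathcal{C}$. Let either $(A_n,A,A_\theta)=(A_n^{\mathrm{P}},A_C^{\mathrm{P}},A_{C_\theta}^{\mathrm{P}})$ or $(A_n,A,A_\theta)=(A_n^{\mathrm{CFG}},A_C^{\mathrm{CFG}},A_{C_\theta}^{\mathrm{CFG}})$. Let $\theta_n$ be a rank-based, $\mathcal{O}$-valued consistent estimator of some $\theta^*\in\mathcal{O}$. Assume that (A) $\mathcal{O}$ is an open subset of $\mathbb{R}^p$; (B) for every $\theta\in\mathcal{O}$, $A_\theta$ is twice continuously differentiable on $(0,1)$; (C) for every $\theta\in\mathcal{O}$, the gradient $\dot A_\theta(t)$ of $A_\theta(t)$ with respect to $\theta$ satisfies $\lim_{\epsilon\downarrow0}\sup_{\|\theta'-\theta\|<\epsilon}\sup_{t\in[0,1]}\|\dot A_{\theta'}(t)-\dot A_\theta(t)\|=0$, where $\|\cdot\|$ is the $\ell_2$-norm; and that, as $n\to\infty$, $(\sqrt{n}(A_n-A),\sqrt{n}(\theta_n-\theta^* ))$ converges weakly in $\mathcal{C}[0,1]\times\mathbb{R}^p$ to a Gaussian limit. Let $$S_n=\int_0^1 n\,|A_n(t)-A_{\theta_n}(t)|^2\,dt .$$ If $A\ne A_{\theta^*}$,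 then for every $\epsilon>0$, $$\lim_{n\to\infty}\Pr(S_n>\epsilon)=1 .$$
   Context: The copula of a pair $(X,Y)$ with continuous margins $F,G$ is the joint distribution function of $(F(X),G(Y))$. A copula $C$ is LTD in both arguments if $C(u,v)/(uv)\ge C(u',v')/(u'v')$ for all $0<u\le u'\le1$ and $0<v\le v'\le1$. For a copula $C$ and $t\in[0,1]$, $$A_C^{\mathrm{P}}(t)=1\Big/\int_0^1C(x^{1-t},x^t)\frac{dx}{x},\qquad A_C^{\mathrm{CFG}}(t)=\exp\Big[-\gamma+\int_0^1\{C(x^{1-t},x^t)-\mathbf{1}(x>e^{-1})\}\frac{dx}{x\log(x)}\Big],$$ where $\gamma=-\int_0^\infty\log(x)e^{-x}\,dx$ is Euler's constant. Normalized ranks: $U_i=F_n(X_i)$, $V_i=G_n(Y_i)$, where $F_n(x)=\frac{1}{n+1}\sum_{i=1}^n\mathbf{1}(X_i\le x)$ and $G_n(y)=\frac{1}{n+1}\sum_{i=1}^n\mathbf{1}(Y_i\le y)$. "Rank-based" means a function of $(U_1,V_1),\ldots,(U_n,V_n)$. For $i\in\{1,\ldots,n\}$ let $\xi_i(0)=-\log U_i$, $\xi_i(1)=-\log V_i$ and, for $t\in(0,1)$, $\xi_i(t)=\min\{-\log(U_i)/(1-t),\,-\log(V_i)/t\}$. The estimators are $$A_n^{\mathrm{P}}(t)=1\Big/\Big\{\frac1n\sum_{i=1}^n\xi_i(t)\Big\},\qquad A_n^{\mathrm{CFG}}(t)=\exp\Big[-\gamma-\frac1n\sum_{i=1}^n\log\{\xi_i(t)\}\Big],\quad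 t\in[0,1].$$ The first component of the Gaussian limit is, respectively, $$\mathbb{A}_C^{\mathrm{P}}(t)=-\{A_C^{\mathrm{P}}(t)\}^2\int_0^1\mathbb{C}(x^{1-t},x^t)\frac{dx}{x}\quad\text{or}\quad \mathbb{A}_C^{\mathrm{CFG}}(t)=A_C^{\mathrm{CFG}}(t)\int_0^1\mathbb{C}(x^{1-t},x^t)\frac{dx}{x\log(x)},$$ where $\mathbb{C}$ is the Gaussian weak limit of the empirical copula process $\sqrt n(C_n-C)$, $C_n(u,v)=\frac1n\sum_{i=1}^n\mathbf{1}(U_i\le u,V_i\le v)$. Here $\mathcal{C}[0,1]$ is the space of continuous functions on $[0,1]$ with the supremum norm (not to be confused with the copula family $\mathcal{C}$). *)

theory Defs
  imports "HOL-Probability.Probability"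
begin

section \<open>Copulas\<close>

abbreviation margin1 :: "(real \<times> real) measure \<Rightarrow> real measure" where
  "margin1 H \<equiv> distr H borel fst"

abbreviation margin2 :: "(real \<times> real) measure \<Rightarrow> real measure" where
  "margin2 H \<equiv> distr H borel snd"

definition bivariate_law :: "(real \<times> real) measure \<Rightarrow> bool" where
  "bivariate_law H \<longleftrightarrow> prob_space H \<and> sets H = sets borel"

definition continuous_margins :: "(real \<times> real) measure \<Rightarrow> bool" where
  "continuous_margins H \<longleftrightarrow>
     continuous_on UNIV (cdf (margin1 H)) \<and> continuous_on UNIV (cdf (margin2 H))"

text \<open>Copulas are represented as total functions \<open>real \<Rightarrow> real \<Rightarrow> real\<close>;
  only their values on the unit square are meaningful.\<close>

definition has_copula :: "(real \<times> real) measure \<Rightarrow> (real \<Rightarrow> real \<Rightarrow> real) \<Rightarrow> bool" where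
  "has_copula H C \<longleftrightarrow> bivariate_law H \<and> continuous_margins H \<and>
     (\<forall>u\<in>{0..1}. \<forall>v\<in>{0..1}.
        C u v = measure H {(x, y). cdf (margin1 H) x \<le> u \<and> cdf (margin2 H) y \<le> v})"

definition copula :: "(real \<Rightarrow> real \<Rightarrow> real) \<Rightarrow> bool" where
  "copula C \<longleftrightarrow> (\<exists>H. has_copula H C)"

definition LTD :: "(real \<Rightarrow> real \<Rightarrow> real) \<Rightarrow> bool" where
  "LTD C \<longleftrightarrow> (\<forall>u u' v v'. 0 < u \<and> u \<le> u' \<and> u' \<le> 1 \<and> 0 < v \<and> v \<le> v' \<and> v' \<le> 1 \<longrightarrow>
     C u v / (u * v) \<ge> C u' v' / (u' * v'))"

definition A_P :: "(real \<Rightarrow> real \<Rightarrow> real) \<Rightarrow> real \<Rightarrow> real" where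
  "A_P C t = 1 / (LBINT x:{0<..<1}. C (x powr (1 - t)) (x powr t) / x)"

definition A_CFG :: "(real \<Rightarrow> real \<Rightarrow> real) \<Rightarrow> real \<Rightarrow> real" where
  "A_CFG C t = exp (- euler_mascheroni +
     (LBINT x:{0<..<1}. (C (x powr (1 - t)) (x powr t) - of_bool (x > exp (- 1))) / (x * ln x)))"

section \<open>Rank-based estimators\<close>

text \<open>A sample of size \<open>n\<close> consists of the entries with indices \<open>1, \<dots>, n\<close> of a sequence.\<close>

definition edf :: "nat \<Rightarrow> (nat \<Rightarrow> real) \<Rightarrow> real \<Rightarrow> real" where
  "edf n x z = (\<Sum>i=1..n. of_bool (x i \<le> z)) / (real n + 1)"

definition norm_ranks :: "nat \<Rightarrow> (nat \<Rightarrow> real) \<Rightarrow> (nat \<Rightarrow> real) \<Rightarrow> nat \<Rightarrow> real \<times> real" where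
  "norm_ranks n x y = (\<lambda>i\<in>{1..n}. (edf n x (x i), edf n y (y i)))"

definition xi :: "real \<times> real \<Rightarrow> real \<Rightarrow> real" where
  "xi p t = (let (u, v) = p in
     if t = 0 then - ln u else if t = 1 then - ln v
     else min (- ln u / (1 - t)) (- ln v / t))"

text \<open>The estimators, as functions of the sample size, the normalized ranks and \<open>t\<close>.\<close>

definition A_est_P :: "nat \<Rightarrow> (nat \<Rightarrow> real \<times> real) \<Rightarrow> real \<Rightarrow> real" where
  "A_est_P n r t = 1 / ((\<Sum>i=1..n. xi (r i) t) / real n)"

definition A_est_CFG :: "nat \<Rightarrow> (nat \<Rightarrow> real \<times> real) \<Rightarrow> real \<Rightarrow> real" where
  "A_est_CFG n r t = exp (- euler_mascheroni - (\<Sum>i=1..n. ln (xi (r i) t)) / real n)"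

section \<open>Weak convergence to a Gaussian limit\<close>

text \<open>Elements of \<open>cfunspace (top_of_set {0..1}) _\<close> are \<open>undefined\<close> outside the unit interval,
  so functions have to be restricted to \<open>{0..1}\<close>.\<close>

definition C01_Rp :: "((real \<Rightarrow> real) \<times> (real ^ 'p)) metric" where
  "C01_Rp = prod_metric (cfunspace (top_of_set {0..1}) euclidean_metric) euclidean_metric"

definition metric_borel :: "'b metric \<Rightarrow> 'b measure" where
  "metric_borel S = sigma (mspace S) {U. openin (mtopology_of S) U}"

definition converges_weakly ::
    "'b metric \<Rightarrow> 'a measure \<Rightarrow> (nat \<Rightarrow> 'a \<Rightarrow> 'b) \<Rightarrow> 'b measure \<Rightarrow> bool" where
  "converges_weakly S M Z \<nu> \<longleftrightarrow>
     (\<forall>n. Z n \<in> measurable M (metric_borel S)) \<and>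
     prob_space \<nu> \<and> sets \<nu> = sets (metric_borel S) \<and>
     (\<forall>\<Phi>. continuous_map (mtopology_of S) euclideanreal \<Phi> \<and> bounded (\<Phi> ` mspace S) \<longrightarrow>
        (\<lambda>n. LINT \<omega>|M. \<Phi> (Z n \<omega>)) \<longlonglongrightarrow> (LINT z|\<nu>. \<Phi> z))"

text \<open>Point masses count as normal laws; for instance, the coordinate at \<open>t = 0\<close> of the
  limit of an estimated Pickands function is degenerate.\<close>

definition normal_law :: "real measure \<Rightarrow> bool" where
  "normal_law N \<longleftrightarrow> (\<exists>m. N = return borel m) \<or>
     (\<exists>m \<sigma>. \<sigma> > 0 \<and> N = density lborel (\<lambda>x. ennreal (normal_density m \<sigma> x)))"

text \<open>All finite-dimensional distributions are multivariate normal (Cramer-Wold form).\<close>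

definition gaussian_law :: "((real \<Rightarrow> real) \<times> (real ^ 'p)) measure \<Rightarrow> bool" where
  "gaussian_law \<nu> \<longleftrightarrow> (\<forall>T (a :: real \<Rightarrow> real) (b :: real ^ 'p). finite T \<and> T \<subseteq> {0..1} \<longrightarrow>
     normal_law (distr \<nu> borel (\<lambda>(f, w). (\<Sum>t\<in>T. a t * f t) + b \<bullet> w)))"

section \<open>Further notions\<close>

definition converges_in_prob ::
    "'a measure \<Rightarrow> (nat \<Rightarrow> 'a \<Rightarrow> 'b::metric_space) \<Rightarrow> 'b \<Rightarrow> bool" where
  "converges_in_prob M Z c \<longleftrightarrow>
     (\<forall>\<epsilon>>0. (\<lambda>n. measure M {\<omega> \<in> space M. dist (Z n \<omega>) c > \<epsilon>}) \<longlonglongrightarrow> 0)"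

definition twice_cont_diff_on :: "(real \<Rightarrow> real) \<Rightarrow> real set \<Rightarrow> bool" where
  "twice_cont_diff_on f S \<longleftrightarrow>
     (\<exists>f'. (\<forall>x\<in>S. (f has_real_derivative f' x) (at x)) \<and> f' C1_differentiable_on S)"

definition random_sample ::
    "'a measure \<Rightarrow> (nat \<Rightarrow> 'a \<Rightarrow> real) \<Rightarrow> (nat \<Rightarrow> 'a \<Rightarrow> real) \<Rightarrow> (real \<times> real) measure \<Rightarrow> bool" where
  "random_sample M X Y H \<longleftrightarrow> prob_space M \<and>
     prob_space.indep_vars M (\<lambda>_. borel) (\<lambda>i \<omega>. (X i \<omega>, Y i \<omega>)) {1..} \<and>
     (\<forall>i\<ge>1. distr M borel (\<lambda>\<omega>. (X i \<omega>, Y i \<omega>)) = H)"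

end

theory Submission
  imports Defs
begin

text \<open>Weak convergence makes \<open>sqrt n * (A\<^sub>n - A)\<close> and \<open>sqrt n * (\<theta>\<^sub>n - \<theta>*)\<close> bounded in probability. Near \<open>\<theta>*\<close> the map
  \<open>\<theta> \<mapsto> A\<^sub>\<theta>(t)\<close> is Lipschitz uniformly in \<open>t\<close>, so \<open>sqrt n * (A\<^sub>n - A\<^sub>\<theta>\<^sub>n)\<close> stays within a bounded distance of
  \<open>sqrt n * (A - A\<^sub>\<theta>\<^sub>*)\<close>, which grows like \<open>sqrt n\<close> on a nondegenerate interval: \<open>A\<close> and \<open>A\<^sub>\<theta>\<^sub>*\<close> are continuous on
  \<open>(0,1)\<close> and agree at the endpoints. The LTD hypothesis gives \<open>C(u,v) \<ge> uv\<close> and hence the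
  boundedness of \<open>A\<^sub>\<theta>\<close> needed for the Lipschitz bound.\<close>

section \<open>Copulas\<close>

lemma bivariate_law_coordinates:
  assumes "bivariate_law H"
  shows "fst \<in> borel_measurable H" and "snd \<in> borel_measurable H"
  using assms measurable_cong_sets[of H borel borel borel]
  by (auto simp: bivariate_law_def intro!: borel_measurable_continuous_onI continuous_intros)

text \<open>A distribution function never exceeds 1, so the defining event is the whole space. This
  normalizes the LTD ratio at the corner.\<close>

lemma copula_corner:
  assumes "copula C"
  shows "C 1 1 = 1"
proof -
  obtain H where H: "has_copula H C" using assms by (auto simp: copula_def)
  then have law: "bivariate_law H" by (simp add: has_copula_def)
  then have "prob_space H" and sets: "sets H = sets borel"
    by (auto simp: bivariate_law_def)
  then interpret prob_space H by simp
  interpret F: real_distribution "margin1 H"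
    by (intro real_distribution_distr bivariate_law_coordinates law)
  interpret G: real_distribution "margin2 H"
    by (intro real_distribution_distr bivariate_law_coordinates law)
  have "{(x, y). cdf (margin1 H) x \<le> 1 \<and> cdf (margin2 H) y \<le> 1} = space H"
    using F.cdf_bounded_prob G.cdf_bounded_prob sets_eq_imp_space_eq[OF sets] by auto
  then show ?thesis
    using H prob_space by (simp add: has_copula_def)
qed

text \<open>By monotonicity and continuity the sublevel set is a closed half-line
  \<open>{..m}\<close>, whose mass is the value of the distribution function at \<open>m\<close>.
  Since 0 < u < 1, the tail limits make the set nonempty and bounded above.\<close>

lemma probability_integral_transform:
  fixes N :: "real measure"
  assumes "real_distribution N" and cont: "continuous_on UNIV (cdf N)"
    and u: "0 < u" "u < 1"
  shows "measure N {x. cdf N x \<le> u} = u"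
proof -
  interpret real_distribution N by fact
  have "eventually (\<lambda>x. cdf N x < u) at_bot"
    using cdf_lim_at_bot u(1) by (rule order_tendstoD)
  then obtain a where a: "\<And>x. x \<le> a \<Longrightarrow> cdf N x < u"
    by (auto simp: eventually_at_bot_linorder)
  have "eventually (\<lambda>x. cdf N x > u) at_top"
    using cdf_lim_at_top_prob u(2) by (rule order_tendstoD)
  then obtain b where b: "\<And>x. x \<ge> b \<Longrightarrow> cdf N x > u"
    by (auto simp: eventually_at_top_linorder)
  define m where "m = Sup {x. cdf N x \<le> u}"
  have ne: "{x. cdf N x \<le> u} \<noteq> {}" using a[of a] by (auto intro: less_imp_le)
  have bdd: "bdd_above {x. cdf N x \<le> u}"
    using b by (intro bdd_aboveI[of _ b]) (meson leI less_imp_le mem_Collect_eq not_le)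
  have "closed {x. cdf N x \<le> u}"
    using cont by (intro closed_Collect_le) auto
  then have m: "cdf N m \<le> u"
    using closed_contains_Sup[OF ne bdd] unfolding m_def by auto
  have set_eq: "{x. cdf N x \<le> u} = {..m}"
    using m cdf_nondecreasing cSup_upper[OF _ bdd] unfolding m_def
    by (auto intro: order_trans)
  \<comment> \<open>The intermediate value theorem yields some \<open>z\<close> at level
    \<open>u\<close>; as \<open>z\<close> does not exceed \<open>m\<close>, monotonicity raises the
    value at \<open>m\<close> to at least \<open>u\<close>.\<close>
  have "a \<le> b" using a b by (meson dual_order.asym linear)
  then obtain z where "cdf N z = u"
    using IVT'[of "cdf N" a u b] a[of a] b[of b] cont
    by (meson continuous_on_subset less_imp_le order_refl subset_UNIV)
  then have "u \<le> cdf N m"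
    using set_eq cdf_nondecreasing[of z m] by auto
  then show ?thesis
    using m set_eq by (simp add: cdf_def2)
qed

text \<open>An argument equal to 1 imposes no constraint, so the event is the preimage of a
  one-dimensional sublevel set under a coordinate map.\<close>

lemma copula_margins:
  assumes "copula C" and u: "0 < u" "u < 1"
  shows "C u 1 = u" and "C 1 u = u"
proof -
  obtain H where H: "has_copula H C" using assms by (auto simp: copula_def)
  then have law: "bivariate_law H" and "prob_space H" and sets: "sets H = sets borel"
    and cont: "continuous_on UNIV (cdf (margin1 H))" "continuous_on UNIV (cdf (margin2 H))"
    by (auto simp: has_copula_def bivariate_law_def continuous_margins_def)
  then interpret prob_space H by simp
  note fst = bivariate_law_coordinates(1)[OF law] and snd = bivariate_law_coordinates(2)[OF law]
  have F: "real_distribution (margin1 H)" and G: "real_distribution (margin2 H)"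
    using fst snd by simp_all
  have closed: "closed {x. cdf (margin1 H) x \<le> u}" "closed {x. cdf (margin2 H) x \<le> u}"
    using cont by (auto intro!: closed_Collect_le)
  have space: "space H = UNIV" using sets_eq_imp_space_eq[OF sets] by simp
  have eq: "{(x, y). cdf (margin1 H) x \<le> u \<and> cdf (margin2 H) y \<le> 1} =
      fst -` {x. cdf (margin1 H) x \<le> u} \<inter> space H"
    "{(x, y). cdf (margin1 H) x \<le> 1 \<and> cdf (margin2 H) y \<le> u} =
      snd -` {x. cdf (margin2 H) x \<le> u} \<inter> space H"
    using real_distribution.cdf_bounded_prob[OF F] real_distribution.cdf_bounded_prob[OF G] space
    by auto
  show "C u 1 = u"
    using H u eq(1) probability_integral_transform[OF F cont(1) u] measure_distr[OF fst, of "{x. cdf (margin1 H) x \<le> u}"]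
      closed(1) by (simp add: has_copula_def)
  show "C 1 u = u"
    using H u eq(2) probability_integral_transform[OF G cont(2) u] measure_distr[OF snd, of "{x. cdf (margin2 H) x \<le> u}"]
      closed(2) by (simp add: has_copula_def)
qed

text \<open>The LTD ratio is smallest at the corner (1, 1), where it equals 1.\<close>

lemma LTD_copula_ge_product:
  assumes "copula C" "LTD C" "0 < u" "u \<le> 1" "0 < v" "v \<le> 1"
  shows "u * v \<le> C u v"
proof -
  have "C 1 1 / (1 * 1) \<le> C u v / (u * v)"
    using assms(2-6) unfolding LTD_def by (metis zero_less_one order_refl)
  then show ?thesis
    using assms copula_corner[OF assms(1)] by (simp add: field_simps)
qed

text \<open>The two arguments multiply to \<open>x\<close>, whatever \<open>t\<close> is.\<close>

lemma LTD_copula_diagonal_ge: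
  assumes "copula C" "LTD C" "0 < x" "x < 1" "t \<in> {0..1}"
  shows "x \<le> C (x powr (1 - t)) (x powr t)"
proof -
  have "x powr (1 - t) * x powr t = x"
    using assms by (simp add: powr_add[symmetric])
  then show ?thesis
    using LTD_copula_ge_product[OF assms(1,2), of "x powr (1 - t)" "x powr t"] assms
    by (simp add: powr_le1)
qed

text \<open>The integrand is at least 1 because \<open>C\<close> dominates \<open>x\<close> along
  the curve, so the denominator is at least 1.\<close>

lemma A_P_bounded:
  assumes "copula C" "LTD C" "t \<in> {0..1}"
  shows "\<bar>A_P C t\<bar> \<le> 1"
proof (cases "set_integrable lborel {0<..<1} (\<lambda>x. C (x powr (1 - t)) (x powr t) / x)")
  case True
  have "(LBINT x:{0<..<1::real}. 1) \<le> (LBINT x:{0<..<1}. C (x powr (1 - t)) (x powr t) / x)"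
    using LTD_copula_diagonal_ge[OF assms(1,2) _ _ assms(3)] True
    by (intro set_integral_mono) (auto simp: set_integrable_def field_simps)
  then have "1 \<le> (LBINT x:{0<..<1}. C (x powr (1 - t)) (x powr t) / x)"
    by (simp add: set_lebesgue_integral_def)
  then show ?thesis by (simp add: A_P_def)
next
  \<comment> \<open>A non-integrable integrand has integral 0 by default, and division by 0 yields
    0, so the bound survives.\<close>
  case False
  then have "(LBINT x:{0<..<1}. C (x powr (1 - t)) (x powr t) / x) = 0"
    unfolding set_integrable_def set_lebesgue_integral_def by (rule not_integrable_integral_eq)
  then show ?thesis by (simp add: A_P_def)
qed

text \<open>Only the exponent needs an upper bound. As \<open>x * ln x\<close> is negative, the
  quotient is nonpositive up to \<open>exp (- 1)\<close>; beyond that point, replacing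
  \<open>C\<close> by its lower bound \<open>x\<close> enlarges it, and ln x \<le> x - 1 bounds the
  result by 1/x, hence by e.\<close>

lemma A_CFG_bounded:
  assumes "copula C" "LTD C" "t \<in> {0..1}"
  shows "\<bar>A_CFG C t\<bar> \<le> exp (- euler_mascheroni + exp 1)"
proof -
  define f where
    "f x = (C (x powr (1 - t)) (x powr t) - of_bool (x > exp (- 1))) / (x * ln x)" for x :: real
  have f_le: "f x \<le> exp 1" if x: "0 < x" "x < 1" for x
  proof -
    let ?c = "C (x powr (1 - t)) (x powr t)"
    have c: "x \<le> ?c" using LTD_copula_diagonal_ge[OF assms(1,2) x assms(3)] .
    have neg: "x * ln x < 0" using x by (simp add: mult_pos_neg)
    show ?thesis
    proof (cases "x > exp (- 1)")
      case True
      have "(?c - 1) / (x * ln x) \<le> (x - 1) / (x * ln x)"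
        using c neg by (intro divide_right_mono_neg) auto
      also have "\<dots> \<le> 1 / x"
        using ln_le_minus_one[of x] x neg
        by (simp add: divide_simps)
      also have "\<dots> \<le> exp 1"
        using True x by (simp add: exp_minus field_simps)
      finally show ?thesis using True by (simp add: f_def)
    next
      case False
      have "?c / (x * ln x) \<le> 0" using c neg x by (simp add: divide_le_0_iff)
      also have "\<dots> \<le> exp 1" by simp
      finally show ?thesis using False by (simp add: f_def)
    qed
  qed
  have "(LBINT x:{0<..<1}. f x) \<le> exp 1"
  proof (cases "set_integrable lborel {0<..<1} f")
    case True
    then have "(LBINT x:{0<..<1}. f x) \<le> (LBINT x:{0<..<1::real}. exp 1)"
      using f_le by (intro set_integral_mono) (auto simp: set_integrable_def)
    then show ?thesis by (simp add: set_lebesgue_integral_def)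
  next
    case False
    then have "(LBINT x:{0<..<1}. f x) = 0"
      unfolding set_integrable_def set_lebesgue_integral_def by (rule not_integrable_integral_eq)
    then show ?thesis by simp
  qed
  then show ?thesis by (simp add: A_CFG_def f_def)
qed

text \<open>At these \<open>t\<close> one of the two powers is 1, so only the margins of the copula,
  which are uniform, enter the integral.\<close>

lemma A_P_endpoints:
  assumes "copula C" "copula D" "t = 0 \<or> t = 1"
  shows "A_P C t = A_P D t"
proof -
  have "(LBINT x:{0<..<1}. C (x powr (1 - t)) (x powr t) / x) =
      (LBINT x:{0<..<1}. D (x powr (1 - t)) (x powr t) / x)"
    using assms(3) copula_margins[OF assms(1)] copula_margins[OF assms(2)]
    by (intro set_lebesgue_integral_cong) auto
  then show ?thesis by (simp add: A_P_def)
qed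

lemma A_CFG_endpoints:
  assumes "copula C" "copula D" "t = 0 \<or> t = 1"
  shows "A_CFG C t = A_CFG D t"
proof -
  have "(LBINT x:{0<..<1}. (C (x powr (1 - t)) (x powr t) - of_bool (x > exp (- 1))) / (x * ln x)) =
      (LBINT x:{0<..<1}. (D (x powr (1 - t)) (x powr t) - of_bool (x > exp (- 1))) / (x * ln x))"
    using assms(3) copula_margins[OF assms(1)] copula_margins[OF assms(2)]
    by (intro set_lebesgue_integral_cong) auto
  then show ?thesis by (simp add: A_CFG_def)
qed

section \<open>Local Lipschitz bounds from the gradient condition\<close>

text \<open>Mean value inequality on a convex set: by Cauchy-Schwarz the derivative, an inner
  product with the gradient, has operator norm at most \<open>B\<close>.\<close>

lemma GDERIV_norm_bound:
  fixes f :: "'b::real_inner \<Rightarrow> real"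
  assumes "convex S" and "\<And>x. x \<in> S \<Longrightarrow> GDERIV f x :> D x" "\<And>x. x \<in> S \<Longrightarrow> norm (D x) \<le> B"
    and "x \<in> S" "y \<in> S"
  shows "\<bar>f x - f y\<bar> \<le> B * norm (x - y)"
proof -
  have "norm (f x - f y) \<le> B * norm (x - y)"
  proof (rule differentiable_bound[OF assms(1)])
    fix z assume z: "z \<in> S"
    show "(f has_derivative (\<lambda>h. h \<bullet> D z)) (at z within S)"
      using assms(2)[OF z] by (auto simp: gderiv_def intro: has_derivative_at_withinI)
    have "norm (h \<bullet> D z) \<le> B * norm h" for h
    proof -
      have "norm (h \<bullet> D z) \<le> norm h * norm (D z)" by (simp add: Cauchy_Schwarz_ineq2)
      also have "\<dots> \<le> norm h * B" using assms(3)[OF z] by (intro mult_left_mono) auto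
      finally show ?thesis by (simp add: mult.commute)
    qed
    then show "onorm (\<lambda>h. h \<bullet> D z) \<le> B"
      using order_trans[OF norm_ge_zero assms(3)[OF z]] by (intro onorm_bound)
  qed (use assms in auto)
  then show ?thesis by simp
qed

text \<open>No bound on \<open>D \<theta> t\<close> uniform in \<open>t\<close> is assumed: on a small ball \<open>f\<close> differs from its
  linearization by at most the radius, so a large gradient would contradict boundedness of \<open>f\<close>.\<close>

lemma locally_Lipschitz_uniformly:
  fixes f :: "'b::real_inner \<Rightarrow> 'c \<Rightarrow> real"
  assumes "open \<O>" "\<theta> \<in> \<O>"
    and bound: "\<And>\<theta>' t. \<theta>' \<in> \<O> \<Longrightarrow> t \<in> T \<Longrightarrow> \<bar>f \<theta>' t\<bar> \<le> B"
    and grad: "\<And>\<theta>' t. \<theta>' \<in> \<O> \<Longrightarrow> t \<in> T \<Longrightarrow> GDERIV (\<lambda>\<theta>. f \<theta> t) \<theta>' :> D \<theta>' t"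
    and cont: "((\<lambda>\<epsilon>. SUP \<theta>' \<in> \<O> \<inter> ball \<theta> \<epsilon>. SUP t\<in>T.
                 ennreal (norm (D \<theta>' t - D \<theta> t))) \<longlongrightarrow> 0) (at_right 0)"
  obtains r L where "r > 0" "L \<ge> 0"
    "\<And>\<theta>' t. \<theta>' \<in> ball \<theta> r \<Longrightarrow> t \<in> T \<Longrightarrow> \<bar>f \<theta>' t - f \<theta> t\<bar> \<le> L * norm (\<theta>' - \<theta>)"
proof -
  \<comment> \<open>Level 1 is an arbitrary positive choice: on a small ball the gradient then
    deviates from its value at the centre by at most 1.\<close>
  have "eventually (\<lambda>\<epsilon>. (SUP \<theta>' \<in> \<O> \<inter> ball \<theta> \<epsilon>. SUP t\<in>T.
                 ennreal (norm (D \<theta>' t - D \<theta> t))) < 1) (at_right 0)"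
    using cont by (rule order_tendstoD) simp
  then obtain s where s: "s > 0"
    and s1: "\<And>\<epsilon>. 0 < \<epsilon> \<Longrightarrow> \<epsilon> < s \<Longrightarrow> (SUP \<theta>' \<in> \<O> \<inter> ball \<theta> \<epsilon>. SUP t\<in>T.
                 ennreal (norm (D \<theta>' t - D \<theta> t))) < 1"
    by (auto simp: eventually_at_right[of 0 1])
  obtain e where e: "e > 0" "ball \<theta> e \<subseteq> \<O>"
    using assms(1,2) by (meson open_contains_ball)
  define r where "r = min e (s / 2)"
  have r: "r > 0" "r < s" "ball \<theta> r \<subseteq> \<O>" using e s by (auto simp: r_def)
  have D: "norm (D \<theta>' t - D \<theta> t) \<le> 1" if "\<theta>' \<in> ball \<theta> r" "t \<in> T" for \<theta>' t
  proof -
    have "ennreal (norm (D \<theta>' t - D \<theta> t)) \<le> (SUP t\<in>T. ennreal (norm (D \<theta>' t - D \<theta> t)))"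
      using that by (intro SUP_upper)
    also have "\<dots> \<le> (SUP \<theta>' \<in> \<O> \<inter> ball \<theta> r. SUP t\<in>T. ennreal (norm (D \<theta>' t - D \<theta> t)))"
      using that r by (intro SUP_upper) auto
    also have "\<dots> < 1" using s1[of r] r by simp
    finally show ?thesis by (simp add: ennreal_less_one_iff)
  qed
  \<comment> \<open>After subtracting the linear map with gradient \<open>D \<theta> t\<close>, the
    remaining gradient has norm at most 1 on the ball, so the mean value inequality applies.\<close>
  have lin: "\<bar>(f \<theta>' t - f \<theta> t) - (\<theta>' - \<theta>) \<bullet> D \<theta> t\<bar> \<le> norm (\<theta>' - \<theta>)"
    if "\<theta>' \<in> ball \<theta> r" "t \<in> T" for \<theta>' t
  proof -
    have "\<bar>(f \<theta>' t - \<theta>' \<bullet> D \<theta> t) - (f \<theta> t - \<theta> \<bullet> D \<theta> t)\<bar> \<le> 1 * norm (\<theta>' - \<theta>)"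
    proof (rule GDERIV_norm_bound[of "ball \<theta> r" _ "\<lambda>\<theta>'. D \<theta>' t - D \<theta> t"])
      fix x assume x: "x \<in> ball \<theta> r"
      have "GDERIV (\<lambda>\<theta>'. \<theta>' \<bullet> D \<theta> t) x :> D \<theta> t"
        unfolding gderiv_def by (auto intro!: derivative_eq_intros)
      then show "GDERIV (\<lambda>\<theta>'. f \<theta>' t - \<theta>' \<bullet> D \<theta> t) x :> D x t - D \<theta> t"
        using grad[of x t] x r that by (intro GDERIV_diff) auto
    qed (use D that r in auto)
    then show ?thesis by (simp add: inner_diff_left algebra_simps)
  qed
  have norm_D: "norm (D \<theta> t) \<le> 4 * B / r + 1" if t: "t \<in> T" for t
  proof (cases "D \<theta> t = 0")
    case True
    then show ?thesis using bound[OF assms(2) t] r by (simp add: divide_simps)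
  next
    case False
    \<comment> \<open>Half a radius along the gradient the linear part is
      \<open>r / 2 * norm (D \<theta> t)\<close>, whereas \<open>f\<close> changes by at most
      \<open>2 * B\<close> and the linearization errs by at most \<open>r / 2\<close>. Division by
      \<open>r / 2\<close> gives the bound.\<close>
    define \<theta>' where "\<theta>' = \<theta> + (r / 2) *\<^sub>R sgn (D \<theta> t)"
    have "norm (\<theta>' - \<theta>) = r / 2" using False r by (simp add: \<theta>'_def norm_sgn)
    moreover have "(\<theta>' - \<theta>) \<bullet> D \<theta> t = r / 2 * norm (D \<theta> t)"
      using False by (simp add: \<theta>'_def sgn_div_norm dot_square_norm power2_eq_square)
    moreover have \<theta>': "\<theta>' \<in> ball \<theta> r"
      using calculation(1) r by (simp add: dist_norm norm_minus_commute)
    moreover have "\<bar>f \<theta>' t\<bar> \<le> B" "\<bar>f \<theta> t\<bar> \<le> B"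
      using bound[of \<theta>' t] bound[of \<theta> t] \<theta>' r assms(2) t by auto
    ultimately have "r / 2 * norm (D \<theta> t) \<le> 2 * B + r / 2"
      using lin[of \<theta>' t] t by auto
    then show ?thesis using r by (simp add: field_simps)
  qed
  show ?thesis
  \<comment> \<open>The gradient bound plus 1 for the linearization error; the maximum with 0 covers
    an empty \<open>T\<close>, where \<open>B\<close> may be negative.\<close>
  proof (rule that[of r "max 0 (4 * B / r + 2)"])
    fix \<theta>' t assume *: "\<theta>' \<in> ball \<theta> r" "t \<in> T"
    have "\<bar>(\<theta>' - \<theta>) \<bullet> D \<theta> t\<bar> \<le> norm (\<theta>' - \<theta>) * norm (D \<theta> t)"
      by (rule Cauchy_Schwarz_ineq2)
    also have "\<dots> \<le> norm (\<theta>' - \<theta>) * (4 * B / r + 1)"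
      using norm_D[OF *(2)] by (intro mult_left_mono) auto
    finally have "\<bar>f \<theta>' t - f \<theta> t\<bar> \<le> (4 * B / r + 2) * norm (\<theta>' - \<theta>)"
      using lin[OF *] by (simp add: algebra_simps)
    also have "\<dots> \<le> max 0 (4 * B / r + 2) * norm (\<theta>' - \<theta>)"
      by (intro mult_right_mono) auto
    finally show "\<bar>f \<theta>' t - f \<theta> t\<bar> \<le> max 0 (4 * B / r + 2) * norm (\<theta>' - \<theta>)" .
  qed (use r in auto)
qed

section \<open>Tightness\<close>

lemma space_metric_borel [simp]: "space (metric_borel S) = mspace S"
  by (simp add: metric_borel_def space_measure_of_conv)

lemma continuous_map_measurable_metric_borel:
  assumes "continuous_map (mtopology_of S) euclideanreal \<Phi>"
  shows "\<Phi> \<in> borel_measurable (metric_borel S)"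
proof (rule borel_measurableI)
  fix U :: "real set" assume "open U"
  then have "openin (mtopology_of S) {x \<in> topspace (mtopology_of S). \<Phi> x \<in> U}"
    using assms openin_continuous_map_preimage by fastforce
  moreover have "\<Phi> -` U \<inter> space (metric_borel S) = {x \<in> topspace (mtopology_of S). \<Phi> x \<in> U}"
    by auto
  moreover have "{U. openin (mtopology_of S) U} \<subseteq> Pow (mspace S)"
    using openin_subset[of "mtopology_of S"] by auto
  ultimately show "\<Phi> -` U \<inter> space (metric_borel S) \<in> sets (metric_borel S)"
    by (simp add: metric_borel_def sets_measure_of)
qed

text \<open>Bounded continuous functions that equal 1 far from \<open>z0\<close> can have small
  \<open>\<nu>\<close>-integral, weak convergence carries this over to large \<open>n\<close>, and
  Markov's inequality turns it into a bound on the probability of being far away.\<close>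

lemma converges_weakly_bounded_in_prob:
  assumes "prob_space M" and weak: "converges_weakly S M Z \<nu>" and z0: "z0 \<in> mspace S"
    and \<delta>: "\<delta> > 0"
  obtains K where "K > 0"
    "\<And>n. {\<omega>\<in>space M. mdist S (Z n \<omega>) z0 \<ge> K} \<in> sets M"
    "eventually (\<lambda>n. measure M {\<omega>\<in>space M. mdist S (Z n \<omega>) z0 \<ge> K} < \<delta>) sequentially"
proof -
  interpret prob_space M by fact
  have Z: "\<And>n. Z n \<in> measurable M (metric_borel S)" and "prob_space \<nu>"
    and sets: "sets \<nu> = sets (metric_borel S)"
    using weak by (auto simp: converges_weakly_def)
  interpret N: prob_space \<nu> by fact
  let ?d = "\<lambda>z. mdist S z z0"
  have nonneg: "?d z \<ge> 0" for z by simp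
  have contd: "continuous_map (mtopology_of S) euclideanreal ?d"
    using z0 by (intro continuous_map_mdist) auto
  \<comment> \<open>A continuous stand-in for the indicator of distance at least
    \<open>Suc k\<close>: it equals 1 exactly there and tends to 0 pointwise in
    \<open>k\<close>.\<close>
  define \<Phi> where "\<Phi> k z = min 1 (?d z / real (Suc k))" for k z
  have cont: "continuous_map (mtopology_of S) euclideanreal (\<Phi> k)" for k
    unfolding \<Phi>_def using contd
    by (intro continuous_map_real_min continuous_map_real_divide) auto
  have \<Phi>01: "0 \<le> \<Phi> k z" "\<Phi> k z \<le> 1" for k z by (auto simp: \<Phi>_def)
  have meas: "\<Phi> k \<in> borel_measurable (metric_borel S)" for k
    using cont by (rule continuous_map_measurable_metric_borel)
  have "(\<lambda>k. LINT z|\<nu>. \<Phi> k z) \<longlonglongrightarrow> (LINT z|\<nu>. 0)"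
  proof (rule integral_dominated_convergence[where w = "\<lambda>_. 1"])
    show "\<Phi> k \<in> borel_measurable \<nu>" for k
      using meas measurable_cong_sets[OF sets refl] by blast
    show "AE z in \<nu>. (\<lambda>k. \<Phi> k z) \<longlonglongrightarrow> 0"
    proof (rule AE_I2)
      fix z
      have "(\<lambda>k. ?d z / real (Suc k)) \<longlonglongrightarrow> 0"
        by (rule LIMSEQ_Suc[OF lim_const_over_n])
      then have "(\<lambda>k. min 1 (?d z / real (Suc k))) \<longlonglongrightarrow> min 1 0"
        by (intro tendsto_min tendsto_const)
      then show "(\<lambda>k. \<Phi> k z) \<longlonglongrightarrow> 0" by (simp add: \<Phi>_def)
    qed
    show "AE z in \<nu>. norm (\<Phi> k z) \<le> 1" for k using \<Phi>01 by simp
  qed auto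
  then have "eventually (\<lambda>k. (LINT z|\<nu>. \<Phi> k z) < \<delta>) sequentially"
    using \<delta> by (intro order_tendstoD) auto
  then obtain k where k: "(LINT z|\<nu>. \<Phi> k z) < \<delta>"
    by (auto simp: eventually_sequentially)
  have "bounded (\<Phi> k ` mspace S)"
    using \<Phi>01 by (intro boundedI[of _ 1]) auto
  then have "(\<lambda>n. LINT \<omega>|M. \<Phi> k (Z n \<omega>)) \<longlonglongrightarrow> (LINT z|\<nu>. \<Phi> k z)"
    using weak cont by (simp add: converges_weakly_def)
  then have ev: "eventually (\<lambda>n. (LINT \<omega>|M. \<Phi> k (Z n \<omega>)) < \<delta>) sequentially"
    using k by (rule order_tendstoD)
  have "measure M {\<omega>\<in>space M. ?d (Z n \<omega>) \<ge> real (Suc k)} \<le> (LINT \<omega>|M. \<Phi> k (Z n \<omega>))" for n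
  proof -
    have m: "(\<lambda>\<omega>. \<Phi> k (Z n \<omega>)) \<in> borel_measurable M"
      using Z meas by measurable
    have eq: "{\<omega>\<in>space M. ?d (Z n \<omega>) \<ge> real (Suc k)} = {\<omega>\<in>space M. \<Phi> k (Z n \<omega>) \<ge> 1}"
      by (auto simp: \<Phi>_def field_simps)
    have "integrable M (\<lambda>\<omega>. \<Phi> k (Z n \<omega>))"
      using m \<Phi>01 by (intro integrable_const_bound[of _ 1]) auto
    then show ?thesis
      unfolding eq using integral_Markov_inequality_measure[of M "\<lambda>\<omega>. \<Phi> k (Z n \<omega>)" "{}" 1] \<Phi>01
      by simp
  qed
  with ev have "eventually (\<lambda>n. measure M {\<omega>\<in>space M. ?d (Z n \<omega>) \<ge> real (Suc k)} < \<delta>) sequentially"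
    by (auto elim!: eventually_mono intro: le_less_trans)
  moreover have "{\<omega>\<in>space M. ?d (Z n \<omega>) \<ge> real (Suc k)} \<in> sets M" for n
    using measurable_compose[OF Z continuous_map_measurable_metric_borel[OF contd], of n]
    by measurable
  ultimately show ?thesis by (intro that[of "real (Suc k)"]) auto
qed

section \<open>The space of continuous functions on the unit interval times \<open>\<real>\<^sup>p\<close>\<close>

lemma C01_Rp_zero: "(\<lambda>t\<in>{0..1}. 0, 0) \<in> mspace C01_Rp"
proof -
  have "continuous_map (top_of_set {0..1::real}) euclideanreal (\<lambda>t\<in>{0..1}. 0)"
    by (auto intro!: continuous_on_cong[THEN iffD2, OF refl _ continuous_on_const])
  moreover have "(\<lambda>t. 0) ` {0..1::real} = {0::real}" by (simp add: image_constant_conv)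
  ultimately show ?thesis by (simp add: C01_Rp_def)
qed

lemma mspace_C01_Rp_continuous:
  assumes "((\<lambda>t\<in>{0..1}. f t), w) \<in> mspace C01_Rp"
  shows "continuous_on {0..1} f"
proof -
  have "continuous_on {0..1} (\<lambda>t\<in>{0..1}. f t)"
    using assms by (auto simp: C01_Rp_def)
  then show ?thesis by (rule continuous_on_cong[THEN iffD1, rotated 2]) auto
qed

text \<open>The product distance is the Euclidean combination of the two component distances, hence
  dominates each, and the supremum distance dominates the values at points.\<close>

lemma mdist_C01_Rp_bounds:
  assumes "((\<lambda>t\<in>{0..1}. f t), w) \<in> mspace C01_Rp"
    and "mdist C01_Rp ((\<lambda>t\<in>{0..1}. f t), w) (\<lambda>t\<in>{0..1}. 0, 0) \<le> K"
  shows "t \<in> {0..1} \<Longrightarrow> \<bar>f t\<bar> \<le> K" and "norm w \<le> K"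
proof -
  let ?m = "cfunspace (top_of_set {0..1::real}) euclidean_metric :: (real \<Rightarrow> real) metric"
  let ?f = "\<lambda>t\<in>{0..1}. f t" and ?o = "\<lambda>t\<in>{0..1::real}. 0::real"
  have d: "sqrt ((mdist ?m ?f ?o)\<^sup>2 + (norm w)\<^sup>2) \<le> K"
    using assms(2) by (simp add: C01_Rp_def prod_dist_def)
  have mdist_le: "mdist ?m ?f ?o \<le> K"
    by (rule order_trans[OF real_sqrt_sum_squares_ge1 d])
  show "norm w \<le> K"
    by (rule order_trans[OF real_sqrt_sum_squares_ge2 d])
  assume t: "t \<in> {0..1}"
  have "mdist euclidean_metric (?f t) (?o t) \<le> K"
  proof (rule mdist_cfunspace_imp_mdist_le[where f = ?f and g = ?o and x = t])
    show "?f \<in> mspace ?m" using assms(1) by (simp add: C01_Rp_def del: mspace_cfunspace)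
    show "?o \<in> mspace ?m" using C01_Rp_zero by (simp add: C01_Rp_def del: mspace_cfunspace)
    show "mdist ?m ?f ?o \<le> K" by (fact mdist_le)
  qed (use t in auto)
  then show "\<bar>f t\<bar> \<le> K" using t by simp
qed

section \<open>Rank statistics\<close>

text \<open>Each coordinate is k / (n + 1) with k \<le> n, and the rank function is restricted to
  \<open>{1..n}\<close>; hence it lies in a finite product set.\<close>

lemma norm_ranks_finite:
  obtains F where "finite F" "\<And>x y. norm_ranks n x y \<in> F"
proof
  let ?R = "(\<lambda>k. real k / (real n + 1)) ` {..n}"
  show "finite (PiE {1..n} (\<lambda>_. ?R \<times> ?R))"
    by (intro finite_PiE) auto
  have edf: "edf n x z \<in> ?R" for x z
  proof (rule image_eqI)
    let ?k = "\<Sum>i=1..n. of_bool (x i \<le> z) :: nat"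
    show "edf n x z = real ?k / (real n + 1)"
      by (simp add: edf_def)
    have "?k \<le> (\<Sum>i=1..n. 1)" by (intro sum_mono) auto
    then show "?k \<in> {..n}" by simp
  qed
  show "norm_ranks n x y \<in> PiE {1..n} (\<lambda>_. ?R \<times> ?R)" for x y
    using edf by (auto simp: norm_ranks_def PiE_def)
qed

text \<open>\<open>P\<close> is an arbitrary predicate: the event is a finite union of level sets of
  the rank vector, each cut out by finitely many equations on measurable quantities.\<close>

lemma rank_event_measurable:
  assumes "random_sample M X Y H"
  shows "{\<omega> \<in> space M. P (norm_ranks n (\<lambda>i. X i \<omega>) (\<lambda>i. Y i \<omega>))} \<in> sets M"
proof -
  have "prob_space M"
    and indep: "prob_space.indep_vars M (\<lambda>_. borel) (\<lambda>i \<omega>. (X i \<omega>, Y i \<omega>)) {1..}"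
    using assms by (auto simp: random_sample_def)
  then interpret prob_space M by simp
  have pair: "(\<lambda>\<omega>. (X i \<omega>, Y i \<omega>)) \<in> borel_measurable M" if "i \<ge> 1" for i
    using indep that unfolding indep_vars_def2 by auto
  have X: "(\<lambda>\<omega>. X i \<omega>) \<in> borel_measurable M" and Y: "(\<lambda>\<omega>. Y i \<omega>) \<in> borel_measurable M"
    if "i \<ge> 1" for i
    using measurable_compose[OF pair[OF that], of fst borel]
      measurable_compose[OF pair[OF that], of snd borel]
    by (simp_all add: borel_measurable_continuous_onI continuous_intros)
  have edf_X: "(\<lambda>\<omega>. edf n (\<lambda>i. X i \<omega>) (X j \<omega>)) \<in> borel_measurable M"
    and edf_Y: "(\<lambda>\<omega>. edf n (\<lambda>i. Y i \<omega>) (Y j \<omega>)) \<in> borel_measurable M" if "j \<ge> 1" for j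
  proof -
    have "(\<lambda>\<omega>. of_bool (X i \<omega> \<le> X j \<omega>) :: real) \<in> borel_measurable M"
      "(\<lambda>\<omega>. of_bool (Y i \<omega> \<le> Y j \<omega>) :: real) \<in> borel_measurable M" if "i \<ge> 1" for i
    proof -
      note [measurable] = X[OF that] X[OF \<open>j \<ge> 1\<close>] Y[OF that] Y[OF \<open>j \<ge> 1\<close>]
      show "(\<lambda>\<omega>. of_bool (X i \<omega> \<le> X j \<omega>) :: real) \<in> borel_measurable M"
        "(\<lambda>\<omega>. of_bool (Y i \<omega> \<le> Y j \<omega>) :: real) \<in> borel_measurable M"
        unfolding of_bool_def by measurable
    qed
    then show "(\<lambda>\<omega>. edf n (\<lambda>i. X i \<omega>) (X j \<omega>)) \<in> borel_measurable M"
      "(\<lambda>\<omega>. edf n (\<lambda>i. Y i \<omega>) (Y j \<omega>)) \<in> borel_measurable M"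
      unfolding edf_def
      by (intro borel_measurable_divide borel_measurable_sum borel_measurable_const; simp)+
  qed
  obtain F where F: "finite F" "\<And>x y. norm_ranks n x y \<in> F"
    by (rule norm_ranks_finite[of n]) (rule that)
  define R where "R \<omega> = norm_ranks n (\<lambda>i. X i \<omega>) (\<lambda>i. Y i \<omega>)" for \<omega>
  have level: "{\<omega> \<in> space M. R \<omega> = r} \<in> sets M" for r
  \<comment> \<open>A restricted function is determined by its values on \<open>{1..n}\<close>; an
    \<open>r\<close> that is not restricted is never attained.\<close>
  proof (cases "r \<in> extensional {1..n}")
    case True
    have "R \<omega> = r \<longleftrightarrow> (\<forall>j\<in>{1..n}. edf n (\<lambda>i. X i \<omega>) (X j \<omega>) = fst (r j) \<and>
        edf n (\<lambda>i. Y i \<omega>) (Y j \<omega>) = snd (r j))" for \<omega>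
    proof -
      have "R \<omega> = r \<longleftrightarrow> (\<forall>j\<in>{1..n}. R \<omega> j = r j)"
        using True by (auto simp: R_def norm_ranks_def intro: extensionalityI[of _ "{1..n}"])
      then show ?thesis by (auto simp: R_def norm_ranks_def prod_eq_iff)
    qed
    moreover have "{\<omega> \<in> space M. \<forall>j\<in>{1..n}. edf n (\<lambda>i. X i \<omega>) (X j \<omega>) = fst (r j) \<and>
        edf n (\<lambda>i. Y i \<omega>) (Y j \<omega>) = snd (r j)} \<in> sets M"
    proof (rule sets.sets_Collect_finite_All)
      fix j assume "j \<in> {1..n}"
      then have [measurable]: "(\<lambda>\<omega>. edf n (\<lambda>i. X i \<omega>) (X j \<omega>)) \<in> borel_measurable M"
        "(\<lambda>\<omega>. edf n (\<lambda>i. Y i \<omega>) (Y j \<omega>)) \<in> borel_measurable M"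
        using edf_X edf_Y by auto
      show "{\<omega> \<in> space M. edf n (\<lambda>i. X i \<omega>) (X j \<omega>) = fst (r j) \<and>
        edf n (\<lambda>i. Y i \<omega>) (Y j \<omega>) = snd (r j)} \<in> sets M"
        by measurable
    qed simp
    ultimately show ?thesis by simp
  next
    case False
    then have "{\<omega> \<in> space M. R \<omega> = r} = {}" by (auto simp: R_def norm_ranks_def)
    then show ?thesis by (simp only: sets.empty_sets)
  qed
  have "{\<omega> \<in> space M. P (R \<omega>)} = (\<Union>r\<in>{r\<in>F. P r}. {\<omega> \<in> space M. R \<omega> = r})"
    using F(2) by (auto simp: R_def)
  then show ?thesis
    using F(1) level unfolding R_def[symmetric] by (auto intro!: sets.finite_UN)
qed

text \<open>For sample size one the normalized ranks are \<open>(1/2, 1/2)\<close> whatever the data, so both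
  estimators are explicit continuous functions of \<open>t\<close>.\<close>

lemma xi_half:
  assumes "t \<in> {0..1}"
  shows "xi (1/2, 1/2) t = ln 2 / max t (1 - t)"
proof -
  have "ln (1 / 2 :: real) = - ln 2" by (simp add: ln_div)
  then show ?thesis
    using assms by (auto simp: xi_def min_def max_def divide_simps)
qed

lemma A_est_sample_size_one:
  assumes "(A_est, A_of) = (A_est_P, A_P) \<or> (A_est, A_of) = (A_est_CFG, A_CFG)"
  shows "continuous_on {0..1} (A_est 1 (norm_ranks 1 x y))"
proof -
  have r: "norm_ranks 1 x y (Suc 0) = (1/2, 1/2)"
    by (simp add: norm_ranks_def edf_def)
  have max_pos: "max t (1 - t) > 0" for t :: real by (simp add: max_def)
  have "continuous_on {0..1} (\<lambda>t::real. 1 / (ln 2 / max t (1 - t)))"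
    "continuous_on {0..1} (\<lambda>t::real. exp (- euler_mascheroni - ln (ln 2 / max t (1 - t))))"
    using max_pos by (auto intro!: continuous_intros simp: less_imp_neq[symmetric])
  moreover have "A_est_P 1 (norm_ranks 1 x y) t = 1 / (ln 2 / max t (1 - t))"
    "A_est_CFG 1 (norm_ranks 1 x y) t = exp (- euler_mascheroni - ln (ln 2 / max t (1 - t)))"
    if "t \<in> {0..1}" for t
    using xi_half[OF that] r by (simp_all add: A_est_P_def A_est_CFG_def)
  ultimately have "continuous_on {0..1} (A_est_P 1 (norm_ranks 1 x y))"
    "continuous_on {0..1} (A_est_CFG 1 (norm_ranks 1 x y))"
    by (simp_all cong: continuous_on_cong_simp)
  then show ?thesis using assms by auto
qed

section \<open>Consistency of the test\<close>

text \<open>Continuity is available only inside the open interval, so integrability is proved there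
  and extended by the two endpoints. Nonnegativity then allows discarding everything outside
  \<open>{a..b}\<close>.\<close>

lemma set_integral_ge_on_subinterval:
  fixes f :: "real \<Rightarrow> real"
  assumes cont: "continuous_on {0<..<1} f"
    and bound: "\<And>t. t \<in> {0..1} \<Longrightarrow> 0 \<le> f t \<and> f t \<le> B"
    and ab: "0 < a" "a \<le> b" "b < 1"
    and m: "\<And>t. t \<in> {a..b} \<Longrightarrow> m \<le> f t"
  shows "(b - a) * m \<le> (LBINT t:{0..1}. f t)"
proof -
  have "set_integrable lborel {0<..<1} f"
  proof (rule set_integrable_bound)
    show "set_integrable lborel {0<..<1} (\<lambda>_::real. B)"
      by (simp add: set_integrable_def)
    show "set_borel_measurable lborel {0<..<1} f"
      using borel_measurable_continuous_on_indicator[OF _ cont] by (simp add: set_borel_measurable_def)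
    show "AE t in lborel. t \<in> {0<..<1} \<longrightarrow> norm (f t) \<le> norm B"
    proof (intro AE_I2 impI)
      fix t :: real assume "t \<in> {0<..<1}"
      then have "0 \<le> f t" "f t \<le> B" using bound[of t] by auto
      then show "norm (f t) \<le> norm B" by simp
    qed
  qed
  moreover have "set_integrable lborel {0, 1} f"
  proof -
    have "(\<lambda>t. indicat_real {0, 1} t *\<^sub>R f t) =
        (\<lambda>t. indicat_real {0} t *\<^sub>R f 0 + indicat_real {1} t *\<^sub>R f 1)"
      by (auto simp: indicator_def)
    then show ?thesis by (simp add: set_integrable_def)
  qed
  ultimately have "set_integrable lborel ({0<..<1} \<union> {0, 1}) f"
    by (intro set_integrable_Un) auto
  moreover have "{0<..<1} \<union> {0, 1} = {0..1::real}" by auto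
  ultimately have int: "set_integrable lborel {0..1} f" by simp
  have "(b - a) * m = (LBINT t:{a..b}. m)"
    using ab by (simp add: set_lebesgue_integral_def)
  also have "\<dots> \<le> (LBINT t:{a..b}. f t)"
    using m ab by (intro set_integral_mono set_integrable_subset[OF int]) (auto simp: set_integrable_def)
  also have "\<dots> \<le> (LBINT t:{0..1}. f t)"
    using bound int ab set_integrable_subset[OF int, of "{a..b}"]
    unfolding set_lebesgue_integral_def set_integrable_def
    by (intro integral_mono) (auto simp: indicator_def)
  finally show ?thesis .
qed

theorem mainTheorem4:
  fixes M :: "'a measure"
    and X Y :: "nat \<Rightarrow> 'a \<Rightarrow> real"
    and H :: "(real \<times> real) measure"
    and C :: "real \<Rightarrow> real \<Rightarrow> real"
    and \<O> :: "(real ^ 'p) set"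
    and C\<theta> :: "real ^ 'p \<Rightarrow> real \<Rightarrow> real \<Rightarrow> real"
    and A_est :: "nat \<Rightarrow> (nat \<Rightarrow> real \<times> real) \<Rightarrow> real \<Rightarrow> real"
    and A_of :: "(real \<Rightarrow> real \<Rightarrow> real) \<Rightarrow> real \<Rightarrow> real"
    and An :: "nat \<Rightarrow> 'a \<Rightarrow> real \<Rightarrow> real"
    and A :: "real \<Rightarrow> real"
    and A\<theta> :: "real ^ 'p \<Rightarrow> real \<Rightarrow> real"
    and Adot :: "real ^ 'p \<Rightarrow> real \<Rightarrow> real ^ 'p"
    and ranks :: "nat \<Rightarrow> 'a \<Rightarrow> nat \<Rightarrow> real \<times> real"
    and \<theta>n :: "nat \<Rightarrow> 'a \<Rightarrow> real ^ 'p"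
    and \<theta>star :: "real ^ 'p"
    and S :: "nat \<Rightarrow> 'a \<Rightarrow> real"
  assumes family: "\<forall>\<theta>\<in>\<O>. copula (C\<theta> \<theta>) \<and> LTD (C\<theta> \<theta>)"
    and sample: "random_sample M X Y H"
    and copula_C: "has_copula H C" and LTD_C: "LTD C"
    and not_in_family: "\<forall>\<theta>\<in>\<O>. \<exists>u\<in>{0..1}. \<exists>v\<in>{0..1}. C u v \<noteq> C\<theta> \<theta> u v"
    and ranks: "\<And>n \<omega>. ranks n \<omega> = norm_ranks n (\<lambda>i. X i \<omega>) (\<lambda>i. Y i \<omega>)"
    and P_or_CFG: "(A_est, A_of) = (A_est_P, A_P) \<or> (A_est, A_of) = (A_est_CFG, A_CFG)"
    and An: "\<And>n \<omega>. An n \<omega> = A_est n (ranks n \<omega>)"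
    and A: "A = A_of C"
    and A\<theta>: "\<And>\<theta>. A\<theta> \<theta> = A_of (C\<theta> \<theta>)"
    and rank_based: "\<exists>T. \<forall>n. \<forall>\<omega>\<in>space M. \<theta>n n \<omega> = T n (ranks n \<omega>)"
    and \<O>_valued: "\<forall>n. \<forall>\<omega>\<in>space M. \<theta>n n \<omega> \<in> \<O>"
    and \<theta>star: "\<theta>star \<in> \<O>"
    and consistent: "converges_in_prob M \<theta>n \<theta>star"
    and cond_A: "open \<O>"
    and cond_B: "\<forall>\<theta>\<in>\<O>. twice_cont_diff_on (A\<theta> \<theta>) {0<..<1}"
    and gradient: "\<forall>\<theta>\<in>\<O>. \<forall>t\<in>{0..1}. GDERIV (\<lambda>\<theta>'. A\<theta> \<theta>' t) \<theta> :> Adot \<theta> t"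
    and cond_C: "\<forall>\<theta>\<in>\<O>. ((\<lambda>\<epsilon>. SUP \<theta>' \<in> \<O> \<inter> ball \<theta> \<epsilon>. SUP t\<in>{0..1}.
                    ennreal (norm (Adot \<theta>' t - Adot \<theta> t))) \<longlongrightarrow> 0) (at_right 0)"
    and weak: "\<exists>\<nu>. gaussian_law \<nu> \<and> converges_weakly C01_Rp M
                 (\<lambda>n \<omega>. (\<lambda>t\<in>{0..1}. sqrt (real n) * (An n \<omega> t - A t),
                         sqrt (real n) *\<^sub>R (\<theta>n n \<omega> - \<theta>star))) \<nu>"
    and S: "\<And>n \<omega>. S n \<omega> = (LBINT t:{0..1}. real n * \<bar>An n \<omega> t - A\<theta> (\<theta>n n \<omega>) t\<bar>\<^sup>2)"
    and A_neq: "\<exists>t\<in>{0..1}. A t \<noteq> A\<theta> \<theta>star t"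
  shows "\<forall>\<epsilon>>0. (\<lambda>n. measure M {\<omega> \<in> space M. S n \<omega> > \<epsilon>}) \<longlonglongrightarrow> 1"
proof (intro allI impI)
  fix \<epsilon> :: real assume \<epsilon>: "\<epsilon> > 0"
  have "prob_space M" using sample by (simp add: random_sample_def)
  then interpret prob_space M .
  have cop_C: "copula C" using copula_C by (auto simp: copula_def)

  \<comment> \<open>Rescaled estimators and continuity of their paths\<close>
  define g where "g n \<omega> t = sqrt (real n) * (An n \<omega> t - A t)" for n \<omega> t
  define h where "h n \<omega> = sqrt (real n) *\<^sub>R (\<theta>n n \<omega> - \<theta>star)" for n \<omega>
  define Z where "Z n \<omega> = ((\<lambda>t\<in>{0..1}. g n \<omega> t), h n \<omega>)" for n \<omega>
  obtain \<nu> where \<nu>: "converges_weakly C01_Rp M Z \<nu>"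
    using weak unfolding Z_def g_def h_def by blast
  \<comment> \<open>Measurability into \<open>metric_borel\<close> places every path in the space,
    not merely almost every one.\<close>
  have Z_space: "Z n \<omega> \<in> mspace C01_Rp" if "\<omega> \<in> space M" for n \<omega>
    using \<nu> measurable_space[of "Z n" M "metric_borel C01_Rp" \<omega>] that
    by (simp add: converges_weakly_def)
  have cont_g: "continuous_on {0..1} (g n \<omega>)" if "\<omega> \<in> space M" for n \<omega>
    using Z_space[OF that, of n] mspace_C01_Rp_continuous unfolding Z_def by blast
  \<comment> \<open>At n = 1 the scaling factor is 1 and the estimator is explicit and continuous,
    so subtracting the continuous path \<open>g 1 \<omega>\<close> from it leaves
    \<open>A\<close>.\<close>
  have cont_A: "continuous_on {0..1} A"
  proof -
    obtain \<omega> where \<omega>: "\<omega> \<in> space M" using not_empty by blast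
    have "continuous_on {0..1} (An 1 \<omega>)"
      unfolding An ranks by (rule A_est_sample_size_one[OF P_or_CFG])
    then have "continuous_on {0..1} (\<lambda>t. An 1 \<omega> t - g 1 \<omega> t)"
      using cont_g[OF \<omega>, of 1] by (intro continuous_on_diff) auto
    then show ?thesis by (simp add: g_def)
  qed
  have cont_An: "continuous_on {0..1} (An n \<omega>)" if "\<omega> \<in> space M" "n \<ge> 1" for n \<omega>
  proof -
    have "continuous_on {0..1} (\<lambda>t. A t + g n \<omega> t / sqrt (real n))"
      using cont_A cont_g[OF that(1)] that(2) by (intro continuous_intros) auto
    then show ?thesis using that(2) by (simp add: g_def)
  qed
  have cont_A\<theta>: "continuous_on {0<..<1} (A\<theta> \<theta>)" if "\<theta> \<in> \<O>" for \<theta>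
    using cond_B that unfolding twice_cont_diff_on_def
    by (intro continuous_at_imp_continuous_on) (blast intro: DERIV_isCont)

  \<comment> \<open>Bounds uniform in t for the parametric family\<close>
  obtain B where B: "\<And>\<theta> t. \<theta> \<in> \<O> \<Longrightarrow> t \<in> {0..1} \<Longrightarrow> \<bar>A\<theta> \<theta> t\<bar> \<le> B"
  proof (cases "A_of = A_P")
    case True
    then show ?thesis using A_P_bounded family A\<theta> that[of 1] by auto
  next
    case False
    then have "A_of = A_CFG" using P_or_CFG by auto
    then show ?thesis
      using A_CFG_bounded family A\<theta> that[of "exp (- euler_mascheroni + exp 1)"] by auto
  qed
  obtain r L where r: "r > 0" and L: "L \<ge> 0" and Lipschitz:
    "\<And>\<theta> t. \<theta> \<in> ball \<theta>star r \<Longrightarrow> t \<in> {0..1} \<Longrightarrow>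
      \<bar>A\<theta> \<theta> t - A\<theta> \<theta>star t\<bar> \<le> L * norm (\<theta> - \<theta>star)"
  proof (rule locally_Lipschitz_uniformly[OF cond_A \<theta>star, of "{0..1}" A\<theta> B Adot])
    show "((\<lambda>\<epsilon>. SUP \<theta>' \<in> \<O> \<inter> ball \<theta>star \<epsilon>. SUP t\<in>{0..1}.
        ennreal (norm (Adot \<theta>' t - Adot \<theta>star t))) \<longlongrightarrow> 0) (at_right 0)"
      using cond_C \<theta>star by blast
  qed (use B gradient in blast)+

  text \<open>Pickands functions of copulas agree at the endpoints, because the margins are uniform.\<close>
  have "A t = A\<theta> \<theta>star t" if "t = 0 \<or> t = 1" for t
    using P_or_CFG A_P_endpoints[OF cop_C _ that] A_CFG_endpoints[OF cop_C _ that] family \<theta>star A A\<theta>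
    by auto
  then obtain t0 where t0: "0 < t0" "t0 < 1" "A t0 \<noteq> A\<theta> \<theta>star t0"
    using A_neq by (metis atLeastAtMost_iff less_eq_real_def)

  \<comment> \<open>An interval on which the two functions stay apart\<close>
  define c where "c = \<bar>A t0 - A\<theta> \<theta>star t0\<bar> / 2"
  have c: "c > 0" using t0 by (simp add: c_def)
  have "continuous_on {0<..<1} (\<lambda>t. \<bar>A t - A\<theta> \<theta>star t\<bar>)"
    using continuous_on_subset[OF cont_A greaterThanLessThan_subseteq_atLeastAtMost_iff[THEN iffD2]]
      cont_A\<theta>[OF \<theta>star]
    by (intro continuous_intros) auto
  then have "isCont (\<lambda>t. \<bar>A t - A\<theta> \<theta>star t\<bar>) t0"
    using t0 by (simp add: continuous_on_eq_continuous_at)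
  \<comment> \<open>\<open>c\<close> is half the gap at \<open>t0\<close>, so by continuity the gap
    stays above \<open>c\<close> nearby.\<close>
  then have "eventually (\<lambda>t. c < \<bar>A t - A\<theta> \<theta>star t\<bar>) (at t0)"
    unfolding isCont_def using c by (elim order_tendstoD) (simp add: c_def)
  then obtain d where d: "d > 0"
    "\<And>t. t \<noteq> t0 \<Longrightarrow> dist t t0 < d \<Longrightarrow> c < \<bar>A t - A\<theta> \<theta>star t\<bar>"
    by (auto simp: eventually_at)
  \<comment> \<open>Halving keeps \<open>{a..b}\<close> strictly inside the unit interval and within
    distance \<open>d\<close> of \<open>t0\<close>.\<close>
  define e where "e = min (d / 2) (min (t0 / 2) ((1 - t0) / 2))"
  define a b where "a = t0 - e" and "b = t0 + e"
  have e: "e > 0" "e < d" "e < t0" "e < 1 - t0" using d(1) t0 by (auto simp: e_def min_def)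
  have ab: "0 < a" "a < b" "b < 1" using e by (auto simp: a_def b_def)
  have gap: "c \<le> \<bar>A t - A\<theta> \<theta>star t\<bar>" if "t \<in> {a..b}" for t
  proof (cases "t = t0")
    case True
    then show ?thesis using c by (simp add: c_def)
  next
    case False
    have "dist t t0 < d" using that e by (auto simp: a_def b_def dist_real_def)
    then show ?thesis using d(2)[OF False] by simp
  qed

  text \<open>A non-measurable event would have the junk measure \<open>0\<close>; \<open>S n\<close> is measurable because it
    factors through the ranks, which take finitely many values.\<close>
  have ev_S: "{\<omega> \<in> space M. S n \<omega> > \<epsilon>} \<in> sets M" for n
  proof -
    obtain T where T: "\<forall>n. \<forall>\<omega>\<in>space M. \<theta>n n \<omega> = T n (ranks n \<omega>)" using rank_based by blast
    have "{\<omega> \<in> space M. S n \<omega> > \<epsilon>} = {\<omega> \<in> space M.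
        (LBINT t:{0..1}. real n * \<bar>A_est n (ranks n \<omega>) t - A\<theta> (T n (ranks n \<omega>)) t\<bar>\<^sup>2) > \<epsilon>}"
      using T by (auto simp: S An)
    then show ?thesis
      using rank_event_measurable[OF sample, of
        "\<lambda>\<rho>. (LBINT t:{0..1}. real n * \<bar>A_est n \<rho> t - A\<theta> (T n \<rho>) t\<bar>\<^sup>2) > \<epsilon>" n]
      by (simp add: ranks)
  qed

  \<comment> \<open>Pathwise part: \<open>K\<close> bounds both rescaled errors, \<open>near\<close>
    puts the estimate into the Lipschitz ball, and \<open>q\<close> makes the lower bound on the
    integrand, times the length \<open>b - a\<close>, exceed \<open>\<epsilon>\<close>.\<close>
  have large: "S n \<omega> > \<epsilon>"
    if \<omega>: "\<omega> \<in> space M" and n: "n \<ge> 1" and K: "mdist C01_Rp (Z n \<omega>) (\<lambda>t\<in>{0..1}. 0, 0) \<le> K"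
      and near: "K < r * sqrt (real n)"
      and q: "sqrt (\<epsilon> / (b - a)) < c * sqrt (real n) - K - L * K" for n \<omega> K
  proof -
    have gK: "\<bar>g n \<omega> t\<bar> \<le> K" if "t \<in> {0..1}" for t
      using mdist_C01_Rp_bounds(1) Z_space[OF \<omega>] K that unfolding Z_def by blast
    have hK: "norm (h n \<omega>) \<le> K"
      using mdist_C01_Rp_bounds(2) Z_space[OF \<omega>] K unfolding Z_def by blast
    have sn: "sqrt (real n) > 0" using n by simp
    have \<theta>K: "sqrt (real n) * norm (\<theta>n n \<omega> - \<theta>star) \<le> K"
      using hK by (simp add: h_def)
    then have "sqrt (real n) * norm (\<theta>n n \<omega> - \<theta>star) < sqrt (real n) * r"
      using near by (simp add: mult.commute)
    then have ball: "\<theta>n n \<omega> \<in> ball \<theta>star r"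
      using sn by (simp add: dist_norm norm_minus_commute)
    have \<theta>O: "\<theta>n n \<omega> \<in> \<O>" using \<O>_valued \<omega> by blast
    define q where "q = sqrt (\<epsilon> / (b - a))"
    define m where "m = (c * sqrt (real n) - K - L * K)\<^sup>2"
    have q0: "q > 0" using \<epsilon> ab by (simp add: q_def)
    have "q\<^sup>2 < m"
      unfolding m_def using q[folded q_def] q0 by (intro power_strict_mono) auto
    then have m: "\<epsilon> < (b - a) * m"
      using \<epsilon> ab by (simp add: q_def field_simps)
    \<comment> \<open>This bound depends on \<open>n\<close> and \<open>\<omega>\<close>; it serves
      only the integrability of the integrand.\<close>
    obtain B' where B': "\<And>t. t \<in> {0..1} \<Longrightarrow> \<bar>An n \<omega> t\<bar> \<le> B'"
      using compact_continuous_image[OF cont_An[OF \<omega> n] compact_Icc]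
      by (fastforce dest!: compact_imp_bounded simp: bounded_iff)
    have "(b - a) * m \<le> (LBINT t:{0..1}. real n * \<bar>An n \<omega> t - A\<theta> (\<theta>n n \<omega>) t\<bar>\<^sup>2)"
    proof (rule set_integral_ge_on_subinterval)
      show "continuous_on {0<..<1} (\<lambda>t. real n * \<bar>An n \<omega> t - A\<theta> (\<theta>n n \<omega>) t\<bar>\<^sup>2)"
        using continuous_on_subset[OF cont_An[OF \<omega> n]
            greaterThanLessThan_subseteq_atLeastAtMost_iff[THEN iffD2]] cont_A\<theta>[OF \<theta>O]
        by (intro continuous_intros) auto
      show "0 \<le> real n * \<bar>An n \<omega> t - A\<theta> (\<theta>n n \<omega>) t\<bar>\<^sup>2 \<and>
          real n * \<bar>An n \<omega> t - A\<theta> (\<theta>n n \<omega>) t\<bar>\<^sup>2 \<le> real n * (B' + B)\<^sup>2" if "t \<in> {0..1}" for t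
        using B'[OF that] B[OF \<theta>O that] by (intro conjI mult_left_mono power_mono) auto
      show "m \<le> real n * \<bar>An n \<omega> t - A\<theta> (\<theta>n n \<omega>) t\<bar>\<^sup>2" if t: "t \<in> {a..b}" for t
      proof -
        have t01: "t \<in> {0..1}" using t ab by auto
        have 1: "sqrt (real n) * \<bar>An n \<omega> t - A t\<bar> \<le> K"
          using gK[OF t01] by (simp add: g_def abs_mult)
        have "sqrt (real n) * \<bar>A\<theta> (\<theta>n n \<omega>) t - A\<theta> \<theta>star t\<bar> \<le>
            sqrt (real n) * (L * norm (\<theta>n n \<omega> - \<theta>star))"
          using Lipschitz[OF ball t01] by (intro mult_left_mono) auto
        also have "\<dots> = L * (sqrt (real n) * norm (\<theta>n n \<omega> - \<theta>star))" by simp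
        also have "\<dots> \<le> L * K" using \<theta>K L by (rule mult_left_mono)
        finally have 2: "sqrt (real n) * \<bar>A\<theta> (\<theta>n n \<omega>) t - A\<theta> \<theta>star t\<bar> \<le> L * K" .
        \<comment> \<open>Triangle inequality: the gap is at most the difference under study plus
          the two estimation errors, which after scaling are at most \<open>K\<close> and
          \<open>L * K\<close>.\<close>
        have "sqrt (real n) * c \<le> sqrt (real n) * (\<bar>An n \<omega> t - A\<theta> (\<theta>n n \<omega>) t\<bar> +
            \<bar>An n \<omega> t - A t\<bar> + \<bar>A\<theta> (\<theta>n n \<omega>) t - A\<theta> \<theta>star t\<bar>)"
          using gap[OF t] by (intro mult_left_mono) auto
        then have "c * sqrt (real n) - K - L * K \<le>
            sqrt (real n) * \<bar>An n \<omega> t - A\<theta> (\<theta>n n \<omega>) t\<bar>"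
          using 1 2 by (simp add: algebra_simps)
        then have "m \<le> (sqrt (real n) * \<bar>An n \<omega> t - A\<theta> (\<theta>n n \<omega>) t\<bar>)\<^sup>2"
          unfolding m_def using q[folded q_def] q0 by (intro power_mono) auto
        then show ?thesis by (simp add: power_mult_distrib)
      qed
    qed (use ab in auto)
    then show ?thesis using m by (simp add: S)
  qed

  \<comment> \<open>Passage to the limit in probability\<close>
  show "(\<lambda>n. measure M {\<omega> \<in> space M. S n \<omega> > \<epsilon>}) \<longlonglongrightarrow> 1"
  proof (rule order_tendstoI)
    fix y :: real assume y: "y < 1"
    then obtain K where K: "K > 0"
      and ev_K: "\<And>n. {\<omega>\<in>space M. mdist C01_Rp (Z n \<omega>) (\<lambda>t\<in>{0..1}. 0, 0) \<ge> K} \<in> sets M"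
      and bad: "eventually (\<lambda>n. measure M {\<omega>\<in>space M.
          mdist C01_Rp (Z n \<omega>) (\<lambda>t\<in>{0..1}. 0, 0) \<ge> K} < 1 - y) sequentially"
      using converges_weakly_bounded_in_prob[OF \<open>prob_space M\<close> \<nu> C01_Rp_zero, of "1 - y"] by auto
    have sqrt_top: "filterlim (\<lambda>n. sqrt (real n)) at_top sequentially"
      by (rule filterlim_compose[OF sqrt_at_top filterlim_real_sequentially])
    \<comment> \<open>These thresholds are the conditions \<open>near\<close> and \<open>q\<close>
      of \<open>large\<close>, solved for \<open>sqrt (real n)\<close>.\<close>
    have "eventually (\<lambda>n. K / r < sqrt (real n)) sequentially"
      "eventually (\<lambda>n. (sqrt (\<epsilon> / (b - a)) + K + L * K) / c < sqrt (real n)) sequentially"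
      using sqrt_top by (simp_all add: filterlim_at_top_dense)
    then show "eventually (\<lambda>n. y < measure M {\<omega> \<in> space M. S n \<omega> > \<epsilon>}) sequentially"
      using bad eventually_ge_at_top[of 1]
    proof eventually_elim
      case (elim n)
      let ?bad = "{\<omega>\<in>space M. mdist C01_Rp (Z n \<omega>) (\<lambda>t\<in>{0..1}. 0, 0) \<ge> K}"
      \<comment> \<open>Off the bad event, whose probability is below \<open>1 - y\<close>,
        \<open>large\<close> applies.\<close>
      have "space M - ?bad \<subseteq> {\<omega> \<in> space M. S n \<omega> > \<epsilon>}"
        using large[of _ n K] elim r c by (auto simp: field_simps not_le)
      then have "measure M (space M - ?bad) \<le> measure M {\<omega> \<in> space M. S n \<omega> > \<epsilon>}"
        using ev_S by (rule finite_measure_mono)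
      then show ?case using prob_compl[OF ev_K, of n] elim by simp
    qed
  next
    fix y :: real assume "1 < y"
    then show "eventually (\<lambda>n. measure M {\<omega> \<in> space M. S n \<omega> > \<epsilon>} < y) sequentially"
      by (auto intro!: always_eventually le_less_trans[OF prob_le_1])
  qed
qed

end
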